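(* Let $m\ge 0$ be an integer, let $n=2m+1$, and let $a,b\in\mathbb{C}$ be arbitrary. Let $H_n(a,b)$ be the $(n+1)\times(n+1)$ tridiagonal matrix with zero diagonal whose only possibly non-zero entries are, for $k\in\{1,\dots,n\}$, $$h_{k,k+1}=\begin{cases} k & \text{if } k \text{ is even}\\ k+a & \text{if } k \text{ is odd}\end{cases}\qquad\text{and}\qquad h_{n+2-k,\,n+1-k}=\begin{cases} k & \text{if } k \text{ is even}\\ k+b & \text{if } k \text{ is odd,}\end{cases}$$ that is, $$H_n(a,b)=\begin{pmatrix} 0 & 1+a & & & & & \\ n+b & 0 & 2 & & & & \\ & n-1 & 0 & 3+a & & & \\ & & \ddots & \ddots & \ddots & & \\ & & & 3+b & 0 & n-1 & \\ & & & & 2 & 0 & n+a\\ & & & & & 1+b & 0 \end{pmatrix}.$$ Then the $2m+2$ eigenvalues of $H_n(a,b)$ (counted with algebraic multiplicity) are $$\pm\sqrt{(2k+1+a)(2k+1+b)}\quad\text{for } k\in\{0,\dots,m\}.$$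
   Context: Rows and columns of matrices are indexed from $1$ to $n+1$. The symbol $\pm\sqrt{z}$ for a complex number $z$ denotes the two complex square roots of $z$ (both equal to $0$ if $z=0$), so each $k$ contributes two eigenvalues, counted with multiplicity. *)

theory Defs
  imports Complex_Main "Jordan_Normal_Form.Char_Poly"
begin

text \<open>
  The entries are indexed from 1, so \<open>i\<close> and \<open>j\<close> range over \<open>{1..n+1}\<close>. A superdiagonal entry
  \<open>h\<^bsub>k,k+1\<^esub>\<close> has \<open>k = i\<close>; a subdiagonal entry \<open>h\<^bsub>n+2-k,n+1-k\<^esub>\<close> has \<open>k = n + 1 - j\<close>.
\<close>

definition h_entry :: "nat \<Rightarrow> complex \<Rightarrow> complex \<Rightarrow> nat \<Rightarrow> nat \<Rightarrow> complex" where
  "h_entry n a b i j =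
    (if j = i + 1 then (if even i then of_nat i else of_nat i + a)
     else if i = j + 1 then
       (let k = n + 1 - j in if even k then of_nat k else of_nat k + b)
     else 0)"

text \<open>Library matrices are indexed from 0, hence the shift of both indices.\<close>

definition H_mat :: "nat \<Rightarrow> complex \<Rightarrow> complex \<Rightarrow> complex mat" where
  "H_mat n a b = mat (n + 1) (n + 1) (\<lambda>(i, j). h_entry n a b (i + 1) (j + 1))"

lemma h_entry_super:
  "h_entry n a b k (k + 1) = (if even k then of_nat k else of_nat k + a)"
  by (simp add: h_entry_def)

lemma h_entry_sub:
  assumes "k \<in> {1..n}"
  shows "h_entry n a b (n + 2 - k) (n + 1 - k) = (if even k then of_nat k else of_nat k + b)"
proof -
  have "n + 2 - k = n + 1 - k + 1" "n + 1 - (n + 1 - k) = k"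
    using assms by auto
  then show ?thesis
    by (simp add: h_entry_def)
qed

lemma h_entry_zero:
  "j \<noteq> i + 1 \<Longrightarrow> i \<noteq> j + 1 \<Longrightarrow> h_entry n a b i j = 0"
  by (simp add: h_entry_def)

end

theory Submission
  imports Defs
begin

text \<open>
  Identify a vector \<open>v\<close> with the polynomial \<open>p = \<Sum>i. v\<^sub>i x\<^sup>i\<close> of degree at most \<open>n\<close>. Splitting \<open>p\<close>
  into its even part \<open>p\<^sub>0\<close> and its odd part \<open>p\<^sub>1\<close>, the matrix acts as the Dunkl-type operator
  \<open>p \<mapsto> (1 - x\<^sup>2) p' + n x p + a p\<^sub>1 / x + b x p\<^sub>0\<close>. With \<open>s = 1 - x\<^sup>2\<close>, it sends
  \<open>s\<^sup>j\<close> to \<open>(n + b - 2 j) x s\<^sup>j\<close> and \<open>x s\<^sup>j\<close> to \<open>(n + a - 2 j) s\<^sup>j + (2 j - 2 m) s\<^sup>j\<^sup>+\<^sup>1\<close>.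
  In the basis \<open>1, x, s, x s, s\<^sup>2, x s\<^sup>2, \<dots>\<close> it is therefore block lower triangular with diagonal
  blocks of size 2, whose characteristic polynomials are \<open>X\<^sup>2 - (n + a - 2 j) (n + b - 2 j)\<close>.
\<close>

section \<open>Determinants, similarity and sums with two terms\<close>

lemma det_two_by_two:
  fixes A :: "'a :: comm_ring_1 mat"
  assumes A: "A \<in> carrier_mat 2 2"
  shows "det A = A $$ (0,0) * A $$ (1,1) - A $$ (0,1) * A $$ (1,0)"
proof -
  have del: "det (mat_delete A 0 j) = mat_delete A 0 j $$ (0,0)" for j
    by (rule det_single) (use A in \<open>auto simp: mat_delete_def\<close>)
  have "det A = (\<Sum>j<2. A $$ (0,j) * cofactor A 0 j)"
    by (rule laplace_expansion_row[OF A]) simp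
  also have "\<dots> = A $$ (0,0) * A $$ (1,1) - A $$ (0,1) * A $$ (1,0)"
    using A by (simp add: numeral_2_eq_2 cofactor_def del) (simp add: mat_delete_def)
  finally show ?thesis .
qed

text \<open>Induction on \<open>N\<close>, splitting off the last diagonal 2 by 2 block: the block
  above it is zero, so the determinant factors.\<close>

lemma det_block_lower_triangular:
  fixes A :: "'a :: idom mat"
  assumes "A \<in> carrier_mat (2 * N) (2 * N)"
    and "\<And>i j. i < 2 * N \<Longrightarrow> j < 2 * N \<Longrightarrow> i div 2 < j div 2 \<Longrightarrow> A $$ (i,j) = 0"
  shows "det A = (\<Prod>q<N. A $$ (2*q, 2*q) * A $$ (2*q+1, 2*q+1) - A $$ (2*q, 2*q+1) * A $$ (2*q+1, 2*q))"
  using assms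
proof (induction N arbitrary: A)
  case 0
  then show ?case by (simp add: det_dim_zero)
next
  case (Suc N)
  obtain A1 A2 A3 A4 where sp: "split_block A (2*N) (2*N) = (A1,A2,A3,A4)"
    by (metis prod_cases4)
  have dims: "dim_row A = 2*N + 2" "dim_col A = 2*N + 2"
    using Suc.prems(1) by auto
  note blocks = split_block[OF sp dims]
  have eqs: "A1 = mat (2*N) (2*N) (\<lambda>ij. A $$ ij)" "A2 = mat (2*N) 2 (\<lambda>(i,j). A $$ (i, j + 2*N))"
    "A4 = mat 2 2 (\<lambda>(i,j). A $$ (i + 2*N, j + 2*N))"
    using sp dims by (auto simp: split_block_def Let_def)
  have A2: "A2 = 0\<^sub>m (2*N) 2"
    unfolding eqs by (rule eq_matI) (auto intro!: Suc.prems(2))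
  have "det A1 = (\<Prod>q<N. A1 $$ (2*q, 2*q) * A1 $$ (2*q+1, 2*q+1) - A1 $$ (2*q, 2*q+1) * A1 $$ (2*q+1, 2*q))"
    by (rule Suc.IH[OF blocks(1)]) (auto simp: eqs intro!: Suc.prems(2))
  also have "\<dots> = (\<Prod>q<N. A $$ (2*q, 2*q) * A $$ (2*q+1, 2*q+1) - A $$ (2*q, 2*q+1) * A $$ (2*q+1, 2*q))"
    by (intro prod.cong refl) (auto simp: eqs)
  finally have A1: "det A1 = \<dots>" .
  have "det A = det A1 * det A4"
    unfolding blocks(5) by (rule det_four_block_mat_upper_right_zero[OF blocks(1) A2 blocks(3,4)])
  then show ?case
    by (simp add: A1 det_two_by_two[OF blocks(4)]) (simp add: eqs add.commute)
qed

text \<open>Allows a change of basis to be verified as \<open>A * P = P * B\<close>, without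
  computing the inverse of \<open>P\<close>.\<close>

lemma char_poly_eq_if_intertwined:
  fixes A B P :: "'a :: field mat"
  assumes A: "A \<in> carrier_mat n n" and B: "B \<in> carrier_mat n n" and P: "P \<in> carrier_mat n n"
    and det: "det P \<noteq> 0" and AP: "A * P = P * B"
  shows "char_poly A = char_poly B"
proof -
  obtain Q where Q: "Q \<in> carrier_mat n n" and QP: "Q * P = 1\<^sub>m n" and PQ: "P * Q = 1\<^sub>m n"
    using det_non_zero_imp_unit[OF P det, of "()"] by (auto simp: Units_def ring_mat_def)
  have "A = A * (P * Q)"
    using A by (simp add: PQ)
  also have "\<dots> = P * B * Q"
    using assoc_mult_mat[OF A P Q] by (simp add: AP)
  finally have "similar_mat A B"
    by (intro similar_matI[OF _ PQ QP]) (use A B P Q in auto)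
  then show ?thesis
    by (rule char_poly_similar)
qed

text \<open>Evaluates entries of products in which one factor is tridiagonal with zero
  diagonal.\<close>

lemma sum_neighbours:
  fixes f :: "nat \<Rightarrow> 'a :: comm_monoid_add"
  assumes "i < N" and zero: "\<And>k. k < N \<Longrightarrow> k \<noteq> i + 1 \<Longrightarrow> i \<noteq> k + 1 \<Longrightarrow> f k = 0"
  shows "sum f {0..<N} = (if i + 1 < N then f (i + 1) else 0) + (if i = 0 then 0 else f (i - 1))"
proof -
  \<comment> \<open>The condition \<open>k \<noteq> i\<close> removes the spurious index
    \<open>i - 1 = i\<close>, which truncated subtraction yields for \<open>i = 0\<close>.\<close>
  have "sum f {0..<N} = sum f ({i + 1, i - 1} \<inter> {k. k < N \<and> k \<noteq> i})"
  proof (rule sum.mono_neutral_right)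
    show "\<forall>k \<in> {0..<N} - {i + 1, i - 1} \<inter> {k. k < N \<and> k \<noteq> i}. f k = 0"
    proof
      fix k
      assume "k \<in> {0..<N} - {i + 1, i - 1} \<inter> {k. k < N \<and> k \<noteq> i}"
      then have "k < N" "k \<noteq> i + 1" "i \<noteq> k + 1"
        by auto
      then show "f k = 0"
        by (rule zero)
    qed
  qed auto
  also have "{i + 1, i - 1} \<inter> {k. k < N \<and> k \<noteq> i} =
      (if i + 1 < N then {i + 1} else {}) \<union> (if i = 0 then {} else {i - 1})"
    using assms(1) by auto
  also have "sum f \<dots> = (if i + 1 < N then f (i + 1) else 0) + (if i = 0 then 0 else f (i - 1))"
    by (auto simp: add.commute)
  finally show ?thesis .
qed

section \<open>The change of basis\<close>

text \<open>The coefficient of \<open>x\<^sup>2\<^sup>p\<close> in \<open>(1 - x\<^sup>2)\<^sup>q\<close>.\<close>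

definition binom_coeff :: "nat \<Rightarrow> nat \<Rightarrow> complex" where
  "binom_coeff p q = (-1) ^ p * of_nat (q choose p)"

text \<open>With y = x^2, this compares coefficients in (1 - y) f' = -q f for f = (1 - y)^q.\<close>

lemma binom_coeff_Suc_left:
  "of_nat (p + 1) * binom_coeff (p + 1) q = (of_nat p - of_nat q) * binom_coeff p q"
proof (cases "p \<le> q")
  case True
  have "(p + 1) * (q choose (p + 1)) = (q - p) * (q choose p)"
    by (metis Suc_eq_plus1 binomial_absorption binomial_absorb_comp)
  then have "of_nat (p + 1) * of_nat (q choose (p + 1)) = (of_nat q - of_nat p :: complex) * of_nat (q choose p)"
    using True by (metis of_nat_diff of_nat_mult)
  then have "(-1) ^ (p + 1) * (of_nat (p + 1) * of_nat (q choose (p + 1))) =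
      (-1) ^ (p + 1) * ((of_nat q - of_nat p :: complex) * of_nat (q choose p))"
    by (rule arg_cong)
  then show ?thesis
    by (simp only: binom_coeff_def) (simp add: algebra_simps)
qed (simp add: binom_coeff_def binomial_eq_0)

text \<open>Coefficient form of (1 - y)^(q+1) = (1 - y)^q - y (1 - y)^q.\<close>

lemma binom_coeff_Suc_right:
  "binom_coeff (p + 1) (q + 1) = binom_coeff (p + 1) q - binom_coeff p q"
  by (simp add: binom_coeff_def algebra_simps)

lemma binom_coeff_0 [simp]: "binom_coeff 0 q = 1"
  by (simp add: binom_coeff_def)

text \<open>Column \<open>j\<close> lists the coefficients of \<open>s ^ (j div 2)\<close> for even \<open>j\<close> and of \<open>x * s ^ (j div 2)\<close> for odd \<open>j\<close>.\<close>

definition basis_mat :: "nat \<Rightarrow> complex mat" where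
  "basis_mat m = mat (2*m+2) (2*m+2)
    (\<lambda>(i,j). if even (i + j) then binom_coeff (i div 2) (j div 2) else 0)"

text \<open>Column \<open>j\<close> holds the coordinates of the image of the \<open>j\<close>-th
  basis polynomial. Even columns vanish above the diagonal, which makes the matrix block lower
  triangular.\<close>

definition block_entry :: "nat \<Rightarrow> complex \<Rightarrow> complex \<Rightarrow> nat \<Rightarrow> nat \<Rightarrow> complex" where
  "block_entry m a b i j =
    (if even j then if i = j + 1 then of_nat (2*m+1) + b - of_nat j else 0
     else if j = i + 1 then of_nat (2*m+1) + a - of_nat i
     else if i = j + 1 then of_nat i - of_nat (2*m+2)
     else 0)"

definition block_mat :: "nat \<Rightarrow> complex \<Rightarrow> complex \<Rightarrow> complex mat" where
  "block_mat m a b = mat (2*m+2) (2*m+2) (\<lambda>(i,j). block_entry m a b i j)"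

text \<open>Ordering the basis by degree makes the matrix upper triangular, with leading
  coefficients 1 or -1 on the diagonal.\<close>

lemma det_basis_mat: "det (basis_mat m) \<noteq> 0"
proof -
  have "basis_mat m $$ (i, j) = 0" if "j < i" "i < 2*m+2" for i j
  proof (cases "even (i + j)")
    case True
    then have "j div 2 < i div 2"
      using that by presburger
    then show ?thesis
      using that by (simp add: basis_mat_def binom_coeff_def)
  qed (use that in \<open>simp add: basis_mat_def\<close>)
  then have "upper_triangular (basis_mat m)"
    by (auto simp: upper_triangular_def basis_mat_def)
  then have "det (basis_mat m) = prod_list (diag_mat (basis_mat m))"
    by (rule det_upper_triangular[where n = "2*m+2"]) (simp add: basis_mat_def)
  then show ?thesis
    by (auto simp: prod_list_zero_iff diag_mat_def basis_mat_def binom_coeff_def)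
qed

lemma H_mat_basis_mat: "H_mat (2*m+1) a b * basis_mat m = basis_mat m * block_mat m a b"
proof (rule eq_matI)
  fix i j
  assume "i < dim_row (basis_mat m * block_mat m a b)" "j < dim_col (basis_mat m * block_mat m a b)"
  then have i: "i < 2*m+2" and j: "j < 2*m+2"
    by (auto simp: basis_mat_def block_mat_def)
  define P where "P i j = (if even (i + j) then binom_coeff (i div 2) (j div 2) else 0)" for i j
  have L: "(H_mat (2*m+1) a b * basis_mat m) $$ (i,j) =
      (\<Sum>k=0..<2*m+2. h_entry (2*m+1) a b (i+1) (k+1) * P k j)"
    using i j by (simp add: H_mat_def basis_mat_def scalar_prod_def P_def)
  have R: "(basis_mat m * block_mat m a b) $$ (i,j) =
      (\<Sum>k=0..<2*m+2. P i k * block_entry m a b k j)"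
    using i j by (simp add: block_mat_def basis_mat_def scalar_prod_def P_def)
  have Hs: "(\<Sum>k=0..<2*m+2. h_entry (2*m+1) a b (i+1) (k+1) * P k j) =
     (if i + 1 < 2*m+2 then h_entry (2*m+1) a b (i+1) (i+2) * P (i+1) j else 0) +
     (if i = 0 then 0 else h_entry (2*m+1) a b (i+1) i * P (i-1) j)"
    by (subst sum_neighbours[OF i]) (auto simp: h_entry_zero)
  have Bs: "(\<Sum>k=0..<2*m+2. P i k * block_entry m a b k j) =
     (if j + 1 < 2*m+2 then P i (j+1) * block_entry m a b (j+1) j else 0) +
     (if j = 0 then 0 else P i (j-1) * block_entry m a b (j-1) j)"
    by (subst sum_neighbours[OF j]) (auto simp: block_entry_def)
  define p q where "p = i div 2" and "q = j div 2"
  have "(if i + 1 < 2*m+2 then h_entry (2*m+1) a b (i+1) (i+2) * P (i+1) j else 0) +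
     (if i = 0 then 0 else h_entry (2*m+1) a b (i+1) i * P (i-1) j) =
     (if j + 1 < 2*m+2 then P i (j+1) * block_entry m a b (j+1) j else 0) +
     (if j = 0 then 0 else P i (j-1) * block_entry m a b (j-1) j)" (is "?L = ?R")
  \<comment> \<open>The operator swaps even and odd polynomials, so equal parities give 0 = 0. The
    other two cases are the images of s^q and x s^q.\<close>
  proof (cases "even j"; cases "even i")
    assume "even j" "even i"
    then show ?thesis
      by (auto simp: P_def block_entry_def)
  next
    assume "\<not> even j" "\<not> even i"
    then show ?thesis
      by (auto simp: P_def)
  next
    assume "even j" "\<not> even i"
    then have ij: "i = 2*p+1" "j = 2*q"
      by (auto simp: p_def q_def)
    with i j have pq: "p \<le> m" "q \<le> m"
      by auto
    have "?L = (if p < m then of_nat (2*p+2) * binom_coeff (p+1) q else 0)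
        + (of_nat (2*m+1-2*p) + b) * binom_coeff p q"
      using pq by (auto simp: ij P_def h_entry_def)
    \<comment> \<open>The guard matters only for \<open>p = m\<close>, where
      \<open>q < p + 1\<close> makes the coefficient zero.\<close>
    also have "(if p < m then of_nat (2*p+2) * binom_coeff (p+1) q else 0) =
        2 * (of_nat (p+1) * binom_coeff (p+1) q)"
      using pq by (auto simp: binom_coeff_def binomial_eq_0)
    also have "\<dots> = 2 * ((of_nat p - of_nat q) * binom_coeff p q)"
      by (simp only: binom_coeff_Suc_left)
    also have "of_nat (2*m+1-2*p) = (of_nat (2*m+1) - of_nat (2*p) :: complex)"
      using pq by (subst of_nat_diff) auto
    also have "2 * ((of_nat p - of_nat q) * binom_coeff p q)
        + (of_nat (2*m+1) - of_nat (2*p) + b) * binom_coeff p q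
        = binom_coeff p q * (of_nat (2*m+1) + b - of_nat (2*q))"
      by (simp add: algebra_simps)
    also have "\<dots> = ?R"
      using pq by (auto simp: ij P_def block_entry_def)
    finally show ?thesis .
  next
    assume "\<not> even j" "even i"
    then have ij: "i = 2*p" "j = 2*q+1"
      by (auto simp: p_def q_def)
    with i j have pq: "p \<le> m" "q \<le> m"
      by auto
    have "?R = (if q < m then binom_coeff p (q+1) * (of_nat (2*q+2) - of_nat (2*m+2)) else 0)
        + binom_coeff p q * (of_nat (2*m+1) + a - of_nat (2*q))"
      by (auto simp: ij P_def block_entry_def)
    \<comment> \<open>For \<open>q = m\<close> the power s^(m+1) would exceed degree n, but its
      factor is zero.\<close>
    also have "(if q < m then binom_coeff p (q+1) * (of_nat (2*q+2) - of_nat (2*m+2)) else 0)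
        = binom_coeff p (q+1) * (of_nat (2*q+2) - of_nat (2*m+2))"
      using pq by auto
    finally have R: "?R = binom_coeff p (q+1) * (of_nat (2*q+2) - of_nat (2*m+2))
        + binom_coeff p q * (of_nat (2*m+1) + a - of_nat (2*q))" .
    show ?thesis
    proof (cases p)
      case 0
      then show ?thesis
        unfolding R using pq by (simp add: ij P_def h_entry_def)
    next
      case (Suc r)
      have "?L = (of_nat (2*r+3) + a) * binom_coeff (r+1) q + of_nat (2*m-2*r) * binom_coeff r q"
        using pq by (auto simp: ij P_def h_entry_def Suc algebra_simps)
      also have "of_nat (2*m-2*r) = (of_nat (2*m) - of_nat (2*r) :: complex)"
        using pq Suc by (subst of_nat_diff) auto
      \<comment> \<open>Splitting 2r + 3 as 2(r + 1) + 1 exposes the left side of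
        \<open>binom_coeff_Suc_left\<close>.\<close>
      also have "(of_nat (2*r+3) + a) * binom_coeff (r+1) q + \<dots> * binom_coeff r q
        = 2 * (of_nat (r+1) * binom_coeff (r+1) q) + (1 + a) * binom_coeff (r+1) q
          + (of_nat (2*m) - of_nat (2*r)) * binom_coeff r q"
        by (simp add: algebra_simps)
      also have "\<dots> = ?R"
        unfolding R Suc Suc_eq_plus1 binom_coeff_Suc_left binom_coeff_Suc_right
        by (simp add: algebra_simps)
      finally show ?thesis .
    qed
  qed
  then show "(H_mat (2*m+1) a b * basis_mat m) $$ (i,j) = (basis_mat m * block_mat m a b) $$ (i,j)"
    by (simp only: L R Hs Bs)
qed (auto simp: H_mat_def basis_mat_def block_mat_def)

section \<open>The characteristic polynomial and its roots\<close>

lemma char_poly_H_mat: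
  "char_poly (H_mat (2*m+1) a b) =
    (\<Prod>k\<le>m. [: - ((of_nat (2*k+1) + a) * (of_nat (2*k+1) + b)), 0, 1 :])"
proof -
  let ?c = "\<lambda>k. (of_nat (2*k+1) + a) * (of_nat (2*k+1) + b)"
  let ?M = "char_poly_matrix (block_mat m a b)"
  have carr: "block_mat m a b \<in> carrier_mat (2*m+2) (2*m+2)"
    by (simp add: block_mat_def)
  have entry: "?M $$ (i,j) = (if i = j then [:0,1:] else 0) + [: - block_entry m a b i j :]"
    if "i < 2*m+2" "j < 2*m+2" for i j
    using that by (simp add: char_poly_matrix_def block_mat_def)
  have "char_poly (H_mat (2*m+1) a b) = char_poly (block_mat m a b)"
    by (rule char_poly_eq_if_intertwined[OF _ carr _ det_basis_mat H_mat_basis_mat])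
      (simp_all add: H_mat_def basis_mat_def)
  also have "\<dots> = det ?M"
    by (simp add: char_poly_def)
  also have "\<dots> = (\<Prod>q<Suc m. ?M $$ (2*q, 2*q) * ?M $$ (2*q+1, 2*q+1) - ?M $$ (2*q, 2*q+1) * ?M $$ (2*q+1, 2*q))"
  proof (rule det_block_lower_triangular)
    show "?M \<in> carrier_mat (2 * Suc m) (2 * Suc m)"
      using char_poly_matrix_closed[OF carr] by simp
    fix i j :: nat
    assume ij: "i < 2 * Suc m" "j < 2 * Suc m" "i div 2 < j div 2"
    then have "block_entry m a b i j = 0" "i \<noteq> j"
      by (auto simp: block_entry_def elim!: oddE)
    then show "?M $$ (i,j) = 0"
      using ij by (simp add: entry)
  qed
  \<comment> \<open>Since n - 2q = 2(m - q) + 1, the blocks produce the factors in reverse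
    order.\<close>
  also have "\<dots> = (\<Prod>q<Suc m. [: - ?c (m - q), 0, 1 :])"
  proof (rule prod.cong[OF refl])
    fix q
    assume "q \<in> {..<Suc m}"
    then have q: "q \<le> m"
      by simp
    then have "of_nat (2*m+1) - of_nat (2*q) = (of_nat (2*(m-q)+1) :: complex)"
      by (simp add: of_nat_diff)
    then have "?c (m - q) = (of_nat (2*m+1) + a - of_nat (2*q)) * (of_nat (2*m+1) + b - of_nat (2*q))"
      by (metis add_diff_eq add.commute)
    moreover have "?M $$ (2*q, 2*q) * ?M $$ (2*q+1, 2*q+1) - ?M $$ (2*q, 2*q+1) * ?M $$ (2*q+1, 2*q)
        = [: - ((of_nat (2*m+1) + a - of_nat (2*q)) * (of_nat (2*m+1) + b - of_nat (2*q))), 0, 1 :]"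
      using q by (simp add: entry block_entry_def) (simp add: algebra_simps)
    ultimately show "?M $$ (2*q, 2*q) * ?M $$ (2*q+1, 2*q+1) - ?M $$ (2*q, 2*q+1) * ?M $$ (2*q+1, 2*q)
        = [: - ?c (m - q), 0, 1 :]"
      by (simp only:)
  qed
  also have "\<dots> = (\<Prod>k<Suc m. [: - ?c k, 0, 1 :])"
    by (subst prod.nat_diff_reindex[symmetric]) simp
  finally show ?thesis
    by (simp only: lessThan_Suc_atMost)
qed

text \<open>The polynomial splits as (X - r)(X + r) with r = \<open>csqrt c\<close>; for
  \<open>c = 0\<close> the root 0 is thus counted twice.\<close>

lemma proots_square_minus: "proots [: - c, 0, 1 :] = {# csqrt c, - csqrt c #}"
proof -
  have "[: - c, 0, 1 :] = [: - csqrt c, 1 :] * [: csqrt c, 1 :]"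
    by simp (metis power2_csqrt power2_eq_square)
  then show ?thesis
    by (simp add: proots_mult del: mult_pCons_left mult_pCons_right)
qed

theorem theorem3:
  fixes m n :: nat and a b :: complex
  assumes "n = 2 * m + 1"
  shows "proots (char_poly (H_mat n a b)) =
    (\<Sum>k\<in>{0..m}.
      {# csqrt ((of_nat (2 * k + 1) + a) * (of_nat (2 * k + 1) + b)),
         - csqrt ((of_nat (2 * k + 1) + a) * (of_nat (2 * k + 1) + b)) #})"
  unfolding assms char_poly_H_mat
  by (subst proots_prod) (simp_all only: proots_square_minus atLeast0AtMost, simp_all)

end
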